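(* Let $R=\bigoplus_{\alpha\in\Gamma}R_{\alpha}$ be a gGD domain and let $S\subseteq H$ be a multiplicatively closed subset of the set $H$ of nonzero homogeneous elements of $R$. Then the ring of fractions $R_S$ is a gGD domain.
   Context: All rings are commutative with identity. $\Gamma$ is a nonzero torsionless commutative cancellative monoid, written additively (torsionless is equivalent to the existence of a total order compatible with the monoid operation), with quotient group $\langle\Gamma\rangle$. A graded domain $R=\bigoplus_{\alpha\in\Gamma}R_\alpha$ is an integral domain graded by $\Gamma$; $H=\bigcup_{\alpha\in\Gamma}(R_\alpha\setminus\{0\})$ is its set of nonzero homogeneous elements. The homogeneous quotient field $R_H$ (and likewise $R_S$ for a multiplicative set $S\subseteq H$) is graded by $\langle\Gamma\rangle$ via $\deg(a/b)=\deg(a)-\deg(b)$. A homogeneous overring of $R$ is a ring $T$ with $R\subseteq T\subseteq R_H$ and $T=\bigoplus_{\alpha\in\langle\Gamma\rangle}(T\cap(R_H)_\alpha)$; it is a $\langle\Gamma\rangle$-graded domain. An ideal is homogeneous if it is generated by homogeneous elements. For a homogeneous overring $T$ of $R$, the extension $R\subseteq T$ satisfies gGD (graded going-down) if, whenever $P_0\subseteq P$ are homogeneous prime ideals of $R$ and $Q$ is a homogeneous prime ideal of $T$ with $Q\cap R=P$, there is a homogeneous prime ideal $Q_0$ of $T$ with $Q_0\subseteq Q$ and $Q_0\cap R=P_0$. $R$ is a gGD domain if $R\subseteq T$ satisfies gGD for every homogeneous overring $T$ of $R$. *)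

theory Defs
  imports "HOL-Algebra.Algebra"
begin

text \<open>
  The grading monoid \<open>\<Gamma>\<close> is a submonoid of a commutative group \<open>G\<close> (every commutative cancellative
  monoid embeds in its quotient group).  HOL-Algebra writes groups multiplicatively, so
  \<open>\<alpha> \<otimes>\<^bsub>G\<^esub> \<beta>\<close> is \<open>\<alpha> + \<beta>\<close> and \<open>\<alpha> [^]\<^bsub>G\<^esub> n\<close> is \<open>n\<alpha>\<close>.  The quotient group of \<open>\<Gamma>\<close> is
  \<open>generate G \<Gamma>\<close>.

  Graded domains are subrings \<open>A\<close> of an ambient field \<open>K\<close> (for instance the quotient field of \<open>A\<close>),
  so that rings of fractions and overrings are again subsets of \<open>K\<close>.  The ring on a subset \<open>A\<close> is
  \<open>K\<lparr>carrier := A\<rparr>\<close>; it is automatically an integral domain.  A grading is a family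
  \<open>M :: 'g \<Rightarrow> 'a set\<close>, relevant only on the index monoid.
\<close>

definition torsionless_monoid :: "('g, 'n) monoid_scheme \<Rightarrow> 'g set \<Rightarrow> bool" where
  "torsionless_monoid G \<Gamma> \<longleftrightarrow> submonoid \<Gamma> G \<and>
     (\<forall>\<alpha>\<in>\<Gamma>. \<forall>\<beta>\<in>\<Gamma>. \<forall>n::nat. n > 0 \<longrightarrow> \<alpha> [^]\<^bsub>G\<^esub> n = \<beta> [^]\<^bsub>G\<^esub> n \<longrightarrow> \<alpha> = \<beta>)"

definition internal_direct_sum ::
    "('a, 'm) ring_scheme \<Rightarrow> 'g set \<Rightarrow> ('g \<Rightarrow> 'a set) \<Rightarrow> 'a set \<Rightarrow> bool" where
  "internal_direct_sum K I M A \<longleftrightarrow>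
     (\<forall>i\<in>I. additive_subgroup (M i) K) \<and>
     A = {finsum K x F | x F. finite F \<and> F \<subseteq> I \<and> x \<in> Pi F M} \<and>
     (\<forall>F x. finite F \<and> F \<subseteq> I \<and> x \<in> Pi F M \<and> finsum K x F = \<zero>\<^bsub>K\<^esub> \<longrightarrow> (\<forall>i\<in>F. x i = \<zero>\<^bsub>K\<^esub>))"

definition graded_domain ::
    "('a, 'm) ring_scheme \<Rightarrow> ('g, 'n) monoid_scheme \<Rightarrow> 'g set \<Rightarrow> 'a set \<Rightarrow> ('g \<Rightarrow> 'a set) \<Rightarrow> bool" where
  "graded_domain K G \<Gamma> A M \<longleftrightarrow>
     field K \<and> comm_group G \<and> torsionless_monoid G \<Gamma> \<and> \<Gamma> \<noteq> {\<one>\<^bsub>G\<^esub>} \<and>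
     subring A K \<and> internal_direct_sum K \<Gamma> M A \<and>
     (\<forall>\<alpha>\<in>\<Gamma>. \<forall>\<beta>\<in>\<Gamma>. \<forall>a\<in>M \<alpha>. \<forall>b\<in>M \<beta>. a \<otimes>\<^bsub>K\<^esub> b \<in> M (\<alpha> \<otimes>\<^bsub>G\<^esub> \<beta>))"

definition nonzero_homogeneous ::
    "('a, 'm) ring_scheme \<Rightarrow> 'g set \<Rightarrow> ('g \<Rightarrow> 'a set) \<Rightarrow> 'a set" where
  "nonzero_homogeneous K \<Gamma> M = (\<Union>\<alpha>\<in>\<Gamma>. M \<alpha> - {\<zero>\<^bsub>K\<^esub>})"

text \<open>Nonempty rather than containing \<open>1\<close>, so that either convention is covered.\<close>

definition mult_closed :: "('a, 'm) ring_scheme \<Rightarrow> 'a set \<Rightarrow> bool" where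
  "mult_closed K S \<longleftrightarrow> S \<noteq> {} \<and> (\<forall>s\<in>S. \<forall>t\<in>S. s \<otimes>\<^bsub>K\<^esub> t \<in> S)"

definition fractions :: "('a, 'm) ring_scheme \<Rightarrow> 'a set \<Rightarrow> 'a set \<Rightarrow> 'a set" where
  "fractions K A S = {a \<otimes>\<^bsub>K\<^esub> inv\<^bsub>K\<^esub> s | a s. a \<in> A \<and> s \<in> S}"

text \<open>
  The component of degree \<open>\<gamma>\<close> of \<open>R\<^sub>S\<close> consists of the \<open>a / s\<close> with \<open>deg a - deg s = \<gamma>\<close>, together
  with \<open>0\<close>; the latter has to be added because there may be no \<open>s \<in> S\<close> of a suitable degree.
\<close>

definition fraction_grading ::
    "('a, 'm) ring_scheme \<Rightarrow> ('g, 'n) monoid_scheme \<Rightarrow> 'g set \<Rightarrow> ('g \<Rightarrow> 'a set) \<Rightarrow> 'a set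
      \<Rightarrow> 'g \<Rightarrow> 'a set" where
  "fraction_grading K G \<Gamma> M S \<gamma> = insert \<zero>\<^bsub>K\<^esub>
     {a \<otimes>\<^bsub>K\<^esub> inv\<^bsub>K\<^esub> s | a s \<alpha> \<beta>. \<alpha> \<in> \<Gamma> \<and> \<beta> \<in> \<Gamma> \<and> a \<in> M \<alpha> \<and> s \<in> S \<inter> M \<beta> \<and>
        \<gamma> = \<alpha> \<otimes>\<^bsub>G\<^esub> inv\<^bsub>G\<^esub> \<beta>}"

definition hom_quotient_field ::
    "('a, 'm) ring_scheme \<Rightarrow> 'g set \<Rightarrow> 'a set \<Rightarrow> ('g \<Rightarrow> 'a set) \<Rightarrow> 'a set" where
  "hom_quotient_field K \<Gamma> A M = fractions K A (nonzero_homogeneous K \<Gamma> M)"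

definition hom_quotient_grading ::
    "('a, 'm) ring_scheme \<Rightarrow> ('g, 'n) monoid_scheme \<Rightarrow> 'g set \<Rightarrow> ('g \<Rightarrow> 'a set) \<Rightarrow> 'g \<Rightarrow> 'a set" where
  "hom_quotient_grading K G \<Gamma> M = fraction_grading K G \<Gamma> M (nonzero_homogeneous K \<Gamma> M)"

definition overring_grading ::
    "('a, 'm) ring_scheme \<Rightarrow> ('g, 'n) monoid_scheme \<Rightarrow> 'g set \<Rightarrow> ('g \<Rightarrow> 'a set) \<Rightarrow> 'a set
      \<Rightarrow> 'g \<Rightarrow> 'a set" where
  "overring_grading K G \<Gamma> M T \<gamma> = T \<inter> hom_quotient_grading K G \<Gamma> M \<gamma>"

definition homogeneous_overring ::
    "('a, 'm) ring_scheme \<Rightarrow> ('g, 'n) monoid_scheme \<Rightarrow> 'g set \<Rightarrow> 'a set \<Rightarrow> ('g \<Rightarrow> 'a set)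
      \<Rightarrow> 'a set \<Rightarrow> bool" where
  "homogeneous_overring K G \<Gamma> A M T \<longleftrightarrow>
     subring T K \<and> A \<subseteq> T \<and> T \<subseteq> hom_quotient_field K \<Gamma> A M \<and>
     internal_direct_sum K (generate G \<Gamma>) (overring_grading K G \<Gamma> M T) T"

definition homogeneous_ideal ::
    "('a, 'm) ring_scheme \<Rightarrow> 'g set \<Rightarrow> 'a set \<Rightarrow> ('g \<Rightarrow> 'a set) \<Rightarrow> 'a set \<Rightarrow> bool" where
  "homogeneous_ideal K \<Gamma> A M I \<longleftrightarrow>
     ideal I (K\<lparr>carrier := A\<rparr>) \<and>
     (\<exists>B. B \<subseteq> (\<Union>\<alpha>\<in>\<Gamma>. M \<alpha>) \<and> I = Idl\<^bsub>K\<lparr>carrier := A\<rparr>\<^esub> B)"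

definition homogeneous_prime ::
    "('a, 'm) ring_scheme \<Rightarrow> 'g set \<Rightarrow> 'a set \<Rightarrow> ('g \<Rightarrow> 'a set) \<Rightarrow> 'a set \<Rightarrow> bool" where
  "homogeneous_prime K \<Gamma> A M P \<longleftrightarrow>
     primeideal P (K\<lparr>carrier := A\<rparr>) \<and> homogeneous_ideal K \<Gamma> A M P"

text \<open>Graded going-down for the extension of \<open>A\<close> (graded by \<open>\<Gamma>\<close>) by \<open>T\<close> (graded by \<open>\<Delta>\<close>).\<close>

definition gGD ::
    "('a, 'm) ring_scheme \<Rightarrow> 'g set \<Rightarrow> 'a set \<Rightarrow> ('g \<Rightarrow> 'a set)
      \<Rightarrow> 'g set \<Rightarrow> 'a set \<Rightarrow> ('g \<Rightarrow> 'a set) \<Rightarrow> bool" where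
  "gGD K \<Gamma> A M \<Delta> T N \<longleftrightarrow>
     (\<forall>P\<^sub>0 P Q. homogeneous_prime K \<Gamma> A M P\<^sub>0 \<and> homogeneous_prime K \<Gamma> A M P \<and> P\<^sub>0 \<subseteq> P \<and>
        homogeneous_prime K \<Delta> T N Q \<and> Q \<inter> A = P \<longrightarrow>
        (\<exists>Q\<^sub>0. homogeneous_prime K \<Delta> T N Q\<^sub>0 \<and> Q\<^sub>0 \<subseteq> Q \<and> Q\<^sub>0 \<inter> A = P\<^sub>0))"

definition gGD_domain ::
    "('a, 'm) ring_scheme \<Rightarrow> ('g, 'n) monoid_scheme \<Rightarrow> 'g set \<Rightarrow> 'a set \<Rightarrow> ('g \<Rightarrow> 'a set) \<Rightarrow> bool" where
  "gGD_domain K G \<Gamma> A M \<longleftrightarrow>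
     graded_domain K G \<Gamma> A M \<and>
     (\<forall>T. homogeneous_overring K G \<Gamma> A M T \<longrightarrow>
        gGD K \<Gamma> A M (generate G \<Gamma>) T (overring_grading K G \<Gamma> M T))"

end

theory Submission
  imports Defs
begin

text \<open>
  Localizing at a set \<open>S\<close> of homogeneous elements does not change the homogeneous quotient
  field: a fraction of fractions is a fraction, of the same degree.  Hence a homogeneous overring
  \<open>T\<close> of \<open>R\<^sub>S\<close> is also a homogeneous overring of \<open>R\<close>, with the same grading
  (\<open>homogeneous_overring_fractions\<close>), and \<open>R \<subseteq> T\<close> satisfies graded going-down by assumption.

  To descend along \<open>R\<^sub>S \<subseteq> T\<close> from \<open>Q\<close> to a prime over \<open>P\<^sub>0\<close>, one contracts \<open>P\<^sub>0 \<subseteq> P\<close> to \<open>R\<close>,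
  where the contractions are again homogeneous primes (\<open>contraction_homogeneous_prime\<close>), and goes
  down along \<open>R \<subseteq> T\<close>.  The resulting \<open>Q\<^sub>0 \<subseteq> Q\<close> agrees with \<open>P\<^sub>0\<close> on \<open>R\<close>.  Since the elements of \<open>S\<close>
  are units in \<open>R\<^sub>S\<close> and in \<open>T\<close>, a fraction \<open>a / s\<close> lies in \<open>Q\<^sub>0\<close> or in \<open>P\<^sub>0\<close> exactly when
  \<open>a\<close> does (\<open>mem_ideal_iff_numerator\<close>), so \<open>Q\<^sub>0\<close> lies over \<open>P\<^sub>0\<close> (\<open>gGD_fractions\<close>).

  The remaining work is to see that \<open>R\<^sub>S\<close> is a graded domain (\<open>graded_domain_fractions\<close>).
  Its grading is independent because finitely many nonzero homogeneous fractions have a homogeneous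
  common denominator, which turns a relation among them into one between components of \<open>R\<close>.
\<close>

section \<open>Sums of families of additive subgroups\<close>

text \<open>
  The additive subgroup spanned by the \<open>M i\<close>, as a set of finite sums with one term per index.
  It is the sum occurring in \<^const>\<open>internal_direct_sum\<close>, without the requirement of independence.
\<close>

definition family_sum :: "('a, 'm) ring_scheme \<Rightarrow> 'g set \<Rightarrow> ('g \<Rightarrow> 'a set) \<Rightarrow> 'a set" where
  "family_sum K I M = {finsum K x F | x F. finite F \<and> F \<subseteq> I \<and> x \<in> Pi F M}"

lemma (in ring) finsum_extend_zero:
  assumes "finite F'" "F \<subseteq> F'" "x \<in> F \<rightarrow> carrier R"
  shows "finsum R x F = finsum R (\<lambda>i. if i \<in> F then x i else \<zero>) F'"
  by (rule add.finprod_mono_neutral_cong_left) (use assms in auto)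

lemma (in ring) finsum_in_additive_subgroup:
  assumes "additive_subgroup H R" "x \<in> F \<rightarrow> H"
  shows "finsum R x F \<in> H"
proof -
  interpret H: additive_subgroup H R by fact
  show ?thesis
    using assms(2)
  proof (induction F rule: infinite_finite_induct)
    case (insert i F)
    then have "x \<in> F \<rightarrow> carrier R" "x i \<in> carrier R"
      using H.a_subset by auto
    with insert show ?case
      by (auto simp: finsum_insert)
  qed (auto simp: finsum_infinite)
qed

lemma (in ring) Pi_additive_subgroups:
  assumes "\<And>i. i \<in> I \<Longrightarrow> additive_subgroup (M i) R" "F \<subseteq> I" "x \<in> Pi F M"
  shows "x \<in> F \<rightarrow> carrier R"
proof
  fix i assume "i \<in> F"
  then have "x i \<in> M i" "i \<in> I"
    using assms(2,3) by auto
  then show "x i \<in> carrier R"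
    using additive_subgroup.a_subset[OF assms(1)] by blast
qed

lemma (in ring) additive_subgroup_family_sum:
  assumes M: "\<And>i. i \<in> I \<Longrightarrow> additive_subgroup (M i) R"
  shows "additive_subgroup (family_sum R I M) R"
proof (intro additive_subgroupI add.subgroupI)
  show "family_sum R I M \<subseteq> carrier R"
  proof
    fix a assume "a \<in> family_sum R I M"
    then obtain x F where "F \<subseteq> I" "x \<in> Pi F M" "a = finsum R x F"
      by (auto simp: family_sum_def)
    then show "a \<in> carrier R"
      using Pi_additive_subgroups[of I M F x, OF M] by (simp add: finsum_closed)
  qed
  show "family_sum R I M \<noteq> {}"
    by (auto simp: family_sum_def)
next
  fix a assume "a \<in> family_sum R I M"
  then obtain x F where F: "finite F" "F \<subseteq> I" "x \<in> Pi F M" "a = finsum R x F"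
    by (auto simp: family_sum_def)
  have c: "x \<in> F \<rightarrow> carrier R"
    using Pi_additive_subgroups[OF M F(2,3)] by simp
  have "\<ominus> a = finsum R (\<lambda>i. \<ominus> x i) F"
  proof -
    have "finsum R (\<lambda>i. \<ominus> x i) F \<oplus> a = finsum R (\<lambda>i. \<ominus> x i \<oplus> x i) F"
      unfolding F(4) using c by (subst finsum_addf) auto
    also have "\<dots> = finsum R (\<lambda>i. \<zero>) F"
      using c by (intro finsum_cong') (auto simp: l_neg Pi_def)
    finally show ?thesis
      using c F(4) by (simp add: minus_equality finsum_closed Pi_def)
  qed
  moreover have "(\<lambda>i. \<ominus> x i) \<in> Pi F M"
    using F M by (auto intro!: additive_subgroup.a_inv_closed)
  ultimately show "\<ominus> a \<in> family_sum R I M"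
    unfolding family_sum_def
    by (intro CollectI exI[of _ "\<lambda>i. \<ominus> x i"] exI[of _ F] conjI) (use F in simp_all)
next
  fix a b assume "a \<in> family_sum R I M" "b \<in> family_sum R I M"
  then obtain x F y F' where F: "finite F" "F \<subseteq> I" "x \<in> Pi F M" "a = finsum R x F"
    and F': "finite F'" "F' \<subseteq> I" "y \<in> Pi F' M" "b = finsum R y F'"
    by (auto simp: family_sum_def)
  define x' where "x' = (\<lambda>i. if i \<in> F then x i else \<zero>)"
  define y' where "y' = (\<lambda>i. if i \<in> F' then y i else \<zero>)"
  have xM: "x' \<in> Pi (F \<union> F') M" "y' \<in> Pi (F \<union> F') M"
    using F F' M by (auto simp: x'_def y'_def Pi_iff subset_iff additive_subgroup.zero_closed)
  have c: "x' \<in> F \<union> F' \<rightarrow> carrier R" "y' \<in> F \<union> F' \<rightarrow> carrier R"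
    using Pi_additive_subgroups[OF M _ xM(1)] Pi_additive_subgroups[OF M _ xM(2)] F F' by auto
  have "a = finsum R x' (F \<union> F')" "b = finsum R y' (F \<union> F')"
    unfolding x'_def y'_def F(4) F'(4)
    using finsum_extend_zero[of "F \<union> F'"] F(1) F'(1)
      Pi_additive_subgroups[of I M, OF M F(2,3)] Pi_additive_subgroups[of I M, OF M F'(2,3)] by simp_all
  then have "a \<oplus> b = finsum R (\<lambda>i. x' i \<oplus> y' i) (F \<union> F')"
    using c by (simp add: finsum_addf)
  moreover have "(\<lambda>i. x' i \<oplus> y' i) \<in> Pi (F \<union> F') M"
    using xM M F F' by (auto intro!: additive_subgroup.a_closed)
  ultimately show "a \<oplus> b \<in> family_sum R I M"
    unfolding family_sum_def
    by (intro CollectI exI[of _ "\<lambda>i. x' i \<oplus> y' i"] exI[of _ "F \<union> F'"] conjI)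
      (use F F' in simp_all)
qed

lemma (in ring) family_sum_member:
  assumes "\<And>i. i \<in> I \<Longrightarrow> additive_subgroup (M i) R" "i \<in> I" "a \<in> M i"
  shows "a \<in> family_sum R I M"
proof -
  have "a \<in> carrier R"
    using assms additive_subgroup.a_subset by blast
  then have "a = finsum R (\<lambda>_. a) {i}"
    by (simp add: finsum_insert)
  with assms show ?thesis
    unfolding family_sum_def by (intro CollectI exI[of _ "\<lambda>_. a"] exI[of _ "{i}"]) auto
qed

lemma (in ring) family_sum_minimal:
  assumes "additive_subgroup H R" "\<And>i. i \<in> I \<Longrightarrow> M i \<subseteq> H"
  shows "family_sum R I M \<subseteq> H"
  using assms by (auto simp: family_sum_def intro!: finsum_in_additive_subgroup)

lemma internal_direct_sumD:
  assumes "internal_direct_sum K I M A"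
  shows "\<And>i. i \<in> I \<Longrightarrow> additive_subgroup (M i) K" and "A = family_sum K I M"
    and "\<And>F x i. \<lbrakk>finite F; F \<subseteq> I; x \<in> Pi F M; finsum K x F = \<zero>\<^bsub>K\<^esub>; i \<in> F\<rbrakk> \<Longrightarrow> x i = \<zero>\<^bsub>K\<^esub>"
  using assms unfolding internal_direct_sum_def family_sum_def by blast+

text \<open>
  Independence is formulated for a vanishing sum over one index set; two representations are
  compared by extending both by zero to \<open>F \<union> F'\<close> and subtracting.
\<close>

lemma (in ring) internal_direct_sum_unique:
  assumes D: "internal_direct_sum R I M A"
    and F: "finite F" "F \<subseteq> I" "x \<in> Pi F M" and F': "finite F'" "F' \<subseteq> I" "y \<in> Pi F' M"
    and eq: "finsum R x F = finsum R y F'" and i: "i \<in> F"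
  shows "x i = (if i \<in> F' then y i else \<zero>)"
proof -
  note M = internal_direct_sumD(1)[OF D]
  define x' where "x' = (\<lambda>i. if i \<in> F then x i else \<zero>)"
  define y' where "y' = (\<lambda>i. if i \<in> F' then y i else \<zero>)"
  have xM: "x' \<in> Pi (F \<union> F') M" "y' \<in> Pi (F \<union> F') M"
    using F F' M by (auto simp: x'_def y'_def Pi_iff subset_iff additive_subgroup.zero_closed)
  have c: "x' \<in> F \<union> F' \<rightarrow> carrier R" "y' \<in> F \<union> F' \<rightarrow> carrier R"
    using Pi_additive_subgroups[OF M _ xM(1)] Pi_additive_subgroups[OF M _ xM(2)] F F' by auto
  have e: "finsum R x F = finsum R x' (F \<union> F')" "finsum R y F' = finsum R y' (F \<union> F')"
    unfolding x'_def y'_def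
    using finsum_extend_zero[of "F \<union> F'"] F(1) F'(1)
      Pi_additive_subgroups[of I M, OF M F(2,3)] Pi_additive_subgroups[of I M, OF M F'(2,3)] by simp_all
  have "finsum R (\<lambda>i. x' i \<oplus> \<ominus> y' i) (F \<union> F') \<oplus> finsum R y' (F \<union> F')
      = finsum R (\<lambda>i. x' i \<oplus> \<ominus> y' i \<oplus> y' i) (F \<union> F')"
    using c by (subst finsum_addf) (auto simp: Pi_def)
  also have "\<dots> = finsum R x' (F \<union> F')"
    using c by (intro finsum_cong') (auto simp: a_assoc l_neg Pi_def)
  also have "\<dots> = \<zero> \<oplus> finsum R y' (F \<union> F')"
    using e eq c by (simp add: finsum_closed)
  finally have "finsum R (\<lambda>i. x' i \<oplus> \<ominus> y' i) (F \<union> F') = \<zero>"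
    using c by (subst (asm) add.right_cancel) (auto simp: Pi_def)
  moreover have "(\<lambda>i. x' i \<oplus> \<ominus> y' i) \<in> Pi (F \<union> F') M"
    using xM M F F' by (auto intro!: additive_subgroup.a_closed additive_subgroup.a_inv_closed)
  ultimately have "x' i \<oplus> \<ominus> y' i = \<zero>"
    using internal_direct_sumD(3)[OF D, of "F \<union> F'" "\<lambda>i. x' i \<oplus> \<ominus> y' i" i] F F' i by simp
  moreover have "x' i = (x' i \<oplus> \<ominus> y' i) \<oplus> y' i" "y' i \<in> carrier R"
    using c i by (auto simp: a_assoc l_neg Pi_def)
  ultimately have "x' i = y' i"
    by simp
  with i show ?thesis
    by (simp add: x'_def y'_def)
qed

section \<open>Homogeneous ideals\<close>

lemma (in cring) ideal_subring_iff:
  assumes A: "subring A R"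
  shows "ideal I (R\<lparr>carrier := A\<rparr>) \<longleftrightarrow>
    additive_subgroup I R \<and> I \<subseteq> A \<and> (\<forall>a\<in>A. \<forall>x\<in>I. a \<otimes> x \<in> I)"
proof -
  have A': "subgroup A (add_monoid R)"
    using A by (simp add: subring_def)
  have eq: "add_monoid (R\<lparr>carrier := A\<rparr>) = (add_monoid R)\<lparr>carrier := A\<rparr>"
    by simp
  have cA: "A \<subseteq> carrier R"
    using A by (simp add: subringE)
  show ?thesis
  proof (intro iffI conjI ballI)
    assume I: "ideal I (R\<lparr>carrier := A\<rparr>)"
    then have s: "subgroup I ((add_monoid R)\<lparr>carrier := A\<rparr>)"
      unfolding ideal_def additive_subgroup_def eq by simp
    show "additive_subgroup I R"
      using add.incl_subgroup[OF A' s] by (rule additive_subgroupI)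
    show "I \<subseteq> A"
      using subgroup.subset[OF s] by simp
    show "a \<otimes> x \<in> I" if "a \<in> A" "x \<in> I" for a x
      using ideal.I_l_closed[OF I, of x a] that by simp
  next
    assume I: "additive_subgroup I R \<and> I \<subseteq> A \<and> (\<forall>a\<in>A. \<forall>x\<in>I. a \<otimes> x \<in> I)"
    show "ideal I (R\<lparr>carrier := A\<rparr>)"
    proof (rule idealI)
      show "ring (R\<lparr>carrier := A\<rparr>)"
        using A by (rule subring_is_ring)
      show "subgroup I (add_monoid (R\<lparr>carrier := A\<rparr>))"
        unfolding eq
        by (rule add.subgroup_incl) (use I A' in \<open>auto dest: additive_subgroup.a_subgroup\<close>)
          show "x \<otimes>\<^bsub>R\<lparr>carrier := A\<rparr>\<^esub> a \<in> I" "a \<otimes>\<^bsub>R\<lparr>carrier := A\<rparr>\<^esub> x \<in> I"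
        if "a \<in> I" "x \<in> carrier (R\<lparr>carrier := A\<rparr>)" for a x
      proof -
        have "x \<in> A" "a \<in> carrier R" "x \<in> carrier R"
          using that conjunct1[OF conjunct2[OF I]] cA by auto
        then show "x \<otimes>\<^bsub>R\<lparr>carrier := A\<rparr>\<^esub> a \<in> I" "a \<otimes>\<^bsub>R\<lparr>carrier := A\<rparr>\<^esub> x \<in> I"
          using that I by (simp_all add: m_comm[of a x])
      qed
    qed
  qed
qed

lemma (in ring) additive_subgroup_Int:
  "additive_subgroup H R \<Longrightarrow> additive_subgroup J R \<Longrightarrow> additive_subgroup (H \<inter> J) R"
  by (simp add: additive_subgroup_def add.subgroups_Inter_pair)

text \<open>
  Generation by homogeneous elements is awkward to transport between rings, so it is replaced by
  a condition on the elements: each is a sum of homogeneous elements lying in the ideal.  The finite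
  sums of homogeneous elements of \<open>P\<close> are closed under multiplication by homogeneous elements of
  \<open>A\<close>, hence by all of \<open>A\<close>; so they form an ideal, which contains any homogeneous
  generating set of \<open>P\<close> and therefore equals \<open>P\<close>.
\<close>

lemma (in cring) homogeneous_ideal_iff:
  assumes G: "graded_domain R G \<Gamma> A M"
  shows "homogeneous_ideal R \<Gamma> A M P \<longleftrightarrow>
    ideal P (R\<lparr>carrier := A\<rparr>) \<and> P \<subseteq> family_sum R \<Gamma> (\<lambda>\<alpha>. M \<alpha> \<inter> P)"
proof -
  have A: "subring A R" and D: "internal_direct_sum R \<Gamma> M A"
    and mult: "\<And>\<alpha> \<beta> a b. \<lbrakk>\<alpha> \<in> \<Gamma>; \<beta> \<in> \<Gamma>; a \<in> M \<alpha>; b \<in> M \<beta>\<rbrakk> \<Longrightarrow> a \<otimes> b \<in> M (\<alpha> \<otimes>\<^bsub>G\<^esub> \<beta>)"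
    and \<Gamma>: "submonoid \<Gamma> G"
    using G by (auto simp: graded_domain_def torsionless_monoid_def)
  note Msub = internal_direct_sumD(1)[OF D] and Asum = internal_direct_sumD(2)[OF D]
  interpret A: ring "R\<lparr>carrier := A\<rparr>"
    using A by (rule subring_is_ring)
  have cA: "A \<subseteq> carrier R"
    using A by (simp add: subringE)
  have MA: "M \<alpha> \<subseteq> A" if "\<alpha> \<in> \<Gamma>" for \<alpha>
    using family_sum_member[of \<Gamma> M, OF Msub] that Asum by blast
  show ?thesis
  proof (intro iffI conjI)
    assume "homogeneous_ideal R \<Gamma> A M P"
    then obtain B where P: "ideal P (R\<lparr>carrier := A\<rparr>)" and B: "B \<subseteq> (\<Union>\<alpha>\<in>\<Gamma>. M \<alpha>)"
      and PB: "P = Idl\<^bsub>R\<lparr>carrier := A\<rparr>\<^esub> B"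
      by (auto simp: homogeneous_ideal_def)
    have BA: "B \<subseteq> A"
      using B MA by blast
    have BP: "B \<subseteq> P"
      unfolding PB by (rule A.genideal_self) (use BA in simp)
    have Ps: "additive_subgroup P R" and PA: "P \<subseteq> A" and Pm: "\<And>a x. a \<in> A \<Longrightarrow> x \<in> P \<Longrightarrow> a \<otimes> x \<in> P"
      using P ideal_subring_iff[OF A] by auto
    define J where "J = family_sum R \<Gamma> (\<lambda>\<alpha>. M \<alpha> \<inter> P)"
    have MP: "additive_subgroup (M \<alpha> \<inter> P) R" if "\<alpha> \<in> \<Gamma>" for \<alpha>
      using Msub[OF that] Ps by (rule additive_subgroup_Int)
    have Js: "additive_subgroup J R"
      unfolding J_def using MP by (rule additive_subgroup_family_sum)
    have JP: "J \<subseteq> P"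
      unfolding J_def using Ps by (rule family_sum_minimal) auto
    have hom: "a \<otimes> x \<in> J" if "\<alpha> \<in> \<Gamma>" "a \<in> M \<alpha>" "\<beta> \<in> \<Gamma>" "x \<in> M \<beta> \<inter> P" for \<alpha> \<beta> a x
    proof -
      have "a \<otimes> x \<in> M (\<alpha> \<otimes>\<^bsub>G\<^esub> \<beta>) \<inter> P" "\<alpha> \<otimes>\<^bsub>G\<^esub> \<beta> \<in> \<Gamma>"
        using that mult Pm MA submonoid.m_closed[OF \<Gamma>] by blast+
      then show ?thesis
        unfolding J_def by (intro family_sum_member[of \<Gamma> "\<lambda>\<alpha>. M \<alpha> \<inter> P", OF MP])
    qed
    have "a \<otimes> x \<in> J" if a: "a \<in> A" and x: "x \<in> J" for a x
    proof -
      obtain u F where u: "finite F" "F \<subseteq> \<Gamma>" "u \<in> Pi F M" "a = finsum R u F"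
        using a Asum by (auto simp: family_sum_def)
      obtain v E where v: "finite E" "E \<subseteq> \<Gamma>" "v \<in> Pi E (\<lambda>\<alpha>. M \<alpha> \<inter> P)" "x = finsum R v E"
        using x by (auto simp: J_def family_sum_def)
      have uc: "u \<in> F \<rightarrow> carrier R"
        using Pi_additive_subgroups[OF Msub u(2,3)] .
      have vc: "v \<in> E \<rightarrow> carrier R"
        using Pi_additive_subgroups[OF MP v(2,3)] .
      have xc: "x \<in> carrier R"
        using vc v by (simp add: finsum_closed)
      have "u \<alpha> \<otimes> x \<in> J" if "\<alpha> \<in> F" for \<alpha>
      proof -
        have "u \<alpha> \<otimes> v \<beta> \<in> J" if "\<beta> \<in> E" for \<beta>
          using u(2,3) v(2,3) that \<open>\<alpha> \<in> F\<close> by (intro hom[of \<alpha> _ \<beta>]) (auto simp: Pi_iff)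
        moreover have "u \<alpha> \<otimes> x = finsum R (\<lambda>\<beta>. u \<alpha> \<otimes> v \<beta>) E"
          unfolding v(4) using v(1) vc uc that by (intro finsum_rdistr) auto
        ultimately show ?thesis
          using finsum_in_additive_subgroup[OF Js, of "\<lambda>\<beta>. u \<alpha> \<otimes> v \<beta>" E] by simp
      qed
      then have "finsum R (\<lambda>\<alpha>. u \<alpha> \<otimes> x) F \<in> J"
        using Js by (intro finsum_in_additive_subgroup[of J]) simp_all
      then show ?thesis
        unfolding u(4) using u(1) uc xc by (simp add: finsum_ldistr)
    qed
    then have "ideal J (R\<lparr>carrier := A\<rparr>)"
      using ideal_subring_iff[OF A] Js JP PA by auto
    moreover have "B \<subseteq> J"
      using B BP family_sum_member[of \<Gamma> "\<lambda>\<alpha>. M \<alpha> \<inter> P", OF MP] unfolding J_def by fast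
    ultimately show "P \<subseteq> family_sum R \<Gamma> (\<lambda>\<alpha>. M \<alpha> \<inter> P)"
      unfolding PB J_def[symmetric, unfolded PB] by (rule A.genideal_minimal)
  next
    assume P: "ideal P (R\<lparr>carrier := A\<rparr>) \<and> P \<subseteq> family_sum R \<Gamma> (\<lambda>\<alpha>. M \<alpha> \<inter> P)"
    define B where "B = (\<Union>\<alpha>\<in>\<Gamma>. M \<alpha> \<inter> P)"
    have BA: "B \<subseteq> carrier (R\<lparr>carrier := A\<rparr>)"
      using MA by (auto simp: B_def)
    have "Idl\<^bsub>R\<lparr>carrier := A\<rparr>\<^esub> B \<subseteq> P"
      by (rule A.genideal_minimal) (use P in \<open>auto simp: B_def\<close>)
    moreover have "family_sum R \<Gamma> (\<lambda>\<alpha>. M \<alpha> \<inter> P) \<subseteq> Idl\<^bsub>R\<lparr>carrier := A\<rparr>\<^esub> B"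
      by (rule family_sum_minimal)
        (use A.genideal_ideal[OF BA] A.genideal_self[OF BA] ideal_subring_iff[OF A] in \<open>auto simp: B_def\<close>)
    ultimately have "P = Idl\<^bsub>R\<lparr>carrier := A\<rparr>\<^esub> B"
      using P by blast
    moreover have "B \<subseteq> (\<Union>\<alpha>\<in>\<Gamma>. M \<alpha>)"
      by (auto simp: B_def)
    ultimately show "homogeneous_ideal R \<Gamma> A M P"
      unfolding homogeneous_ideal_def using conjunct1[OF P] by blast
  qed (simp add: homogeneous_ideal_def)
qed

section \<open>Fractions\<close>

lemma (in comm_group) quotient_eq_iff:
  assumes "a \<in> carrier G" "b \<in> carrier G" "c \<in> carrier G" "d \<in> carrier G"
  shows "a \<otimes> inv b = c \<otimes> inv d \<longleftrightarrow> a \<otimes> d = c \<otimes> b"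
proof -
  have "a \<otimes> inv b = c \<otimes> inv d \<longleftrightarrow> a = c \<otimes> inv d \<otimes> b"
    using assms by (metis inv_closed inv_solve_right' m_closed)
  also have "c \<otimes> inv d \<otimes> b = c \<otimes> b \<otimes> inv d"
    using assms by (simp add: m_ac)
  also have "a = c \<otimes> b \<otimes> inv d \<longleftrightarrow> a \<otimes> d = c \<otimes> b"
    using assms by (metis inv_solve_right m_closed)
  finally show ?thesis .
qed

lemma (in comm_group) quotient_mult:
  assumes "a \<in> carrier G" "b \<in> carrier G" "c \<in> carrier G" "d \<in> carrier G"
  shows "(a \<otimes> inv b) \<otimes> (c \<otimes> inv d) = (a \<otimes> c) \<otimes> inv (b \<otimes> d)"
  using assms by (simp add: m_ac inv_mult)

context field
begin

lemma nonzero_inv [simp]: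
  assumes "s \<in> carrier R" "s \<noteq> \<zero>"
  shows "inv s \<in> carrier R" "s \<otimes> inv s = \<one>" "inv s \<otimes> s = \<one>"
  using assms by (auto simp: field_Units)

lemma fraction_eqI:
  assumes "s \<in> carrier R" "s \<noteq> \<zero>" "x \<in> carrier R" "x \<otimes> s = a"
  shows "a \<otimes> inv s = x"
  using assms(4)[symmetric] assms(1-3) by (simp add: m_assoc)

lemma fraction_mult_denominator:
  assumes "s \<in> carrier R" "s \<noteq> \<zero>" "a \<in> carrier R"
  shows "(a \<otimes> inv s) \<otimes> s = a"
  using assms by (simp add: m_assoc)

lemma fraction_mult:
  assumes "a \<in> carrier R" "s \<in> carrier R" "b \<in> carrier R" "t \<in> carrier R" "s \<noteq> \<zero>" "t \<noteq> \<zero>"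
  shows "(a \<otimes> inv s) \<otimes> (b \<otimes> inv t) = (a \<otimes> b) \<otimes> inv (s \<otimes> t)"
proof (rule sym, rule fraction_eqI)
  have "(a \<otimes> inv s) \<otimes> (b \<otimes> inv t) \<otimes> (s \<otimes> t) = ((a \<otimes> inv s) \<otimes> s) \<otimes> ((b \<otimes> inv t) \<otimes> t)"
    using assms by (simp add: m_ac)
  then show "(a \<otimes> inv s) \<otimes> (b \<otimes> inv t) \<otimes> (s \<otimes> t) = a \<otimes> b"
    using assms fraction_mult_denominator by simp
qed (use assms in \<open>auto simp: integral_iff\<close>)

lemma fraction_add:
  assumes "a \<in> carrier R" "s \<in> carrier R" "b \<in> carrier R" "t \<in> carrier R" "s \<noteq> \<zero>" "t \<noteq> \<zero>"
  shows "(a \<otimes> inv s) \<oplus> (b \<otimes> inv t) = (a \<otimes> t \<oplus> b \<otimes> s) \<otimes> inv (s \<otimes> t)"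
proof (rule sym, rule fraction_eqI)
  have "(x \<oplus> y) \<otimes> (s \<otimes> t) = (x \<otimes> s) \<otimes> t \<oplus> (y \<otimes> t) \<otimes> s"
    if "x \<in> carrier R" "y \<in> carrier R" for x y
    using that assms by (subst l_distr) (simp_all add: m_ac)
  from this[of "a \<otimes> inv s" "b \<otimes> inv t"] show "((a \<otimes> inv s) \<oplus> (b \<otimes> inv t)) \<otimes> (s \<otimes> t) = a \<otimes> t \<oplus> b \<otimes> s"
    using assms fraction_mult_denominator by simp
qed (use assms in \<open>auto simp: integral_iff\<close>)

lemma inv_fraction:
  assumes "a \<in> carrier R" "s \<in> carrier R" "a \<noteq> \<zero>" "s \<noteq> \<zero>"
  shows "inv (a \<otimes> inv s) = s \<otimes> inv a"
proof -
  have "s \<otimes> inv a \<otimes> (a \<otimes> inv s) = (s \<otimes> a) \<otimes> inv (a \<otimes> s)"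
    using assms by (intro fraction_mult) auto
  also have "\<dots> = \<one>"
    using assms by (simp add: m_comm[of a s] integral_iff)
  finally have "a \<otimes> inv s \<otimes> (s \<otimes> inv a) = \<one>"
    using assms by (simp add: m_comm)
  then show ?thesis
    using assms by (intro comm_inv_char) auto
qed

end

lemma (in field) mult_closed_nonzero_homogeneous:
  assumes gr: "graded_domain R G \<Gamma> A M" and ne: "nonzero_homogeneous R \<Gamma> M \<noteq> {}"
  shows "mult_closed R (nonzero_homogeneous R \<Gamma> M)"
  unfolding mult_closed_def
proof (intro conjI ballI ne)
  fix s t assume "s \<in> nonzero_homogeneous R \<Gamma> M" "t \<in> nonzero_homogeneous R \<Gamma> M"
  then obtain \<alpha> \<beta> where *: "\<alpha> \<in> \<Gamma>" "s \<in> M \<alpha>" "s \<noteq> \<zero>" "\<beta> \<in> \<Gamma>" "t \<in> M \<beta>" "t \<noteq> \<zero>"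
    by (auto simp: nonzero_homogeneous_def)
  have D: "internal_direct_sum R \<Gamma> M A"
    using gr by (simp add: graded_domain_def)
  have "s \<in> carrier R" "t \<in> carrier R"
    using * additive_subgroup.a_subset[OF internal_direct_sumD(1)[OF D]] by blast+
  then have "s \<otimes> t \<noteq> \<zero>"
    using * by (simp add: integral_iff)
  moreover have "s \<otimes> t \<in> M (\<alpha> \<otimes>\<^bsub>G\<^esub> \<beta>)" "\<alpha> \<otimes>\<^bsub>G\<^esub> \<beta> \<in> \<Gamma>"
    using * gr by (auto simp: graded_domain_def torsionless_monoid_def submonoid.m_closed)
  ultimately show "s \<otimes> t \<in> nonzero_homogeneous R \<Gamma> M"
    unfolding nonzero_homogeneous_def by blast
qed

section \<open>The graded ring of fractions\<close>

text \<open>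
  A ring of fractions that is again graded can itself be localized, so the locale is later
  instantiated with \<open>S\<close> the set of all nonzero homogeneous elements of \<open>R\<close>, and once
  more with \<open>R\<^sub>S\<close> in place of \<open>R\<close>; this identifies the homogeneous quotient fields.
\<close>

locale graded_fractions = field K
  for K :: "('a, 'm) ring_scheme" (structure) +
  fixes G :: "('g, 'n) monoid_scheme" and \<Gamma> :: "'g set" and R :: "'a set"
    and M :: "'g \<Rightarrow> 'a set" and S :: "'a set"
  assumes graded: "graded_domain K G \<Gamma> R M"
    and S_hom: "S \<subseteq> nonzero_homogeneous K \<Gamma> M"
    and S_mult: "mult_closed K S"
begin

abbreviation \<Delta> :: "'g set" where "\<Delta> \<equiv> generate G \<Gamma>"
abbreviation RS :: "'a set" where "RS \<equiv> fractions K R S"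
abbreviation N :: "'g \<Rightarrow> 'a set" where "N \<equiv> fraction_grading K G \<Gamma> M S"

sublocale G: comm_group G
  using graded by (simp add: graded_domain_def)

lemma \<Gamma>_submonoid: "submonoid \<Gamma> G"
  and \<Gamma>_torsionless: "\<lbrakk>\<alpha> \<in> \<Gamma>; \<beta> \<in> \<Gamma>; n > 0; \<alpha> [^]\<^bsub>G\<^esub> (n::nat) = \<beta> [^]\<^bsub>G\<^esub> n\<rbrakk> \<Longrightarrow> \<alpha> = \<beta>"
  using graded by (auto simp: graded_domain_def torsionless_monoid_def)

lemma \<Gamma>_carrier [simp]: "\<alpha> \<in> \<Gamma> \<Longrightarrow> \<alpha> \<in> carrier G"
  and \<Gamma>_closed [simp]: "\<lbrakk>\<alpha> \<in> \<Gamma>; \<beta> \<in> \<Gamma>\<rbrakk> \<Longrightarrow> \<alpha> \<otimes>\<^bsub>G\<^esub> \<beta> \<in> \<Gamma>"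
  and \<Gamma>_one [simp]: "\<one>\<^bsub>G\<^esub> \<in> \<Gamma>"
  using \<Gamma>_submonoid by (auto simp: submonoid_def)

lemma R_subring: "subring R K"
  and direct: "internal_direct_sum K \<Gamma> M R"
  and M_mult [simp]: "\<lbrakk>\<alpha> \<in> \<Gamma>; \<beta> \<in> \<Gamma>; a \<in> M \<alpha>; b \<in> M \<beta>\<rbrakk> \<Longrightarrow> a \<otimes> b \<in> M (\<alpha> \<otimes>\<^bsub>G\<^esub> \<beta>)"
  using graded by (auto simp: graded_domain_def)

lemma M_subgroup: "\<alpha> \<in> \<Gamma> \<Longrightarrow> additive_subgroup (M \<alpha>) K"
  and R_sum: "R = family_sum K \<Gamma> M"
  using internal_direct_sumD(1,2)[OF direct] by auto

lemma M_R: "\<alpha> \<in> \<Gamma> \<Longrightarrow> a \<in> M \<alpha> \<Longrightarrow> a \<in> R"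
  using family_sum_member[of \<Gamma> M, OF M_subgroup] R_sum by blast

lemma R_carrier [simp]: "a \<in> R \<Longrightarrow> a \<in> carrier K"
  using subringE(1)[OF R_subring] by blast

lemma S_nonempty: "S \<noteq> {}" and S_closed [simp]: "\<lbrakk>s \<in> S; t \<in> S\<rbrakk> \<Longrightarrow> s \<otimes> t \<in> S"
  using S_mult by (auto simp: mult_closed_def)

lemma S_degree: "s \<in> S \<Longrightarrow> \<exists>\<beta>\<in>\<Gamma>. s \<in> M \<beta>" and S_nonzero [simp]: "s \<in> S \<Longrightarrow> s \<noteq> \<zero>"
  using S_hom by (auto simp: nonzero_homogeneous_def)

lemma S_R [simp]: "s \<in> S \<Longrightarrow> s \<in> R"
  using S_degree M_R by blast

lemma RS_I: "a \<in> R \<Longrightarrow> s \<in> S \<Longrightarrow> a \<otimes> inv s \<in> RS"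
  by (auto simp: fractions_def)

lemma RS_E:
  assumes "x \<in> RS"
  obtains a s where "a \<in> R" "s \<in> S" "x = a \<otimes> inv s"
  using assms by (auto simp: fractions_def)

lemma N_I:
  assumes "\<alpha> \<in> \<Gamma>" "\<beta> \<in> \<Gamma>" "a \<in> M \<alpha>" "s \<in> S" "s \<in> M \<beta>" "\<gamma> = \<alpha> \<otimes>\<^bsub>G\<^esub> inv\<^bsub>G\<^esub> \<beta>"
  shows "a \<otimes> inv s \<in> N \<gamma>"
  using assms unfolding fraction_grading_def by blast

lemma N_E:
  assumes "x \<in> N \<gamma>"
  obtains "x = \<zero>"
  | a s \<alpha> \<beta> where "\<alpha> \<in> \<Gamma>" "\<beta> \<in> \<Gamma>" "a \<in> M \<alpha>" "s \<in> S" "s \<in> M \<beta>" "x = a \<otimes> inv s"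
      "\<gamma> = \<alpha> \<otimes>\<^bsub>G\<^esub> inv\<^bsub>G\<^esub> \<beta>"
  using assms unfolding fraction_grading_def by blast

lemma N_zero [simp]: "\<zero> \<in> N \<gamma>"
  by (simp add: fraction_grading_def)

lemma \<Delta>_subgroup: "subgroup \<Delta> G"
  by (rule G.generate_is_subgroup) auto

lemma \<Delta>_carrier [simp]: "\<gamma> \<in> \<Delta> \<Longrightarrow> \<gamma> \<in> carrier G"
  using subgroup.subset[OF \<Delta>_subgroup] by blast

lemma \<Delta>_I: "\<alpha> \<in> \<Gamma> \<Longrightarrow> \<beta> \<in> \<Gamma> \<Longrightarrow> \<alpha> \<otimes>\<^bsub>G\<^esub> inv\<^bsub>G\<^esub> \<beta> \<in> \<Delta>"
  by (blast intro: generate.intros)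

lemma \<Gamma>_\<Delta>: "\<alpha> \<in> \<Gamma> \<Longrightarrow> \<alpha> \<in> \<Delta>"
  by (rule generate.incl)

lemma \<Delta>_E:
  assumes "\<gamma> \<in> \<Delta>"
  obtains \<alpha> \<beta> where "\<alpha> \<in> \<Gamma>" "\<beta> \<in> \<Gamma>" "\<gamma> = \<alpha> \<otimes>\<^bsub>G\<^esub> inv\<^bsub>G\<^esub> \<beta>"
proof -
  from assms have "\<exists>\<alpha>\<in>\<Gamma>. \<exists>\<beta>\<in>\<Gamma>. \<gamma> = \<alpha> \<otimes>\<^bsub>G\<^esub> inv\<^bsub>G\<^esub> \<beta>"
  proof (induction rule: generate.induct)
    case one
    then show ?case by (intro bexI[of _ "\<one>\<^bsub>G\<^esub>"]) auto
  next
    case (incl h)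
    then show ?case by (intro bexI[of _ h] bexI[of _ "\<one>\<^bsub>G\<^esub>"]) auto
  next
    case (inv h)
    then show ?case by (intro bexI[of _ h] bexI[of _ "\<one>\<^bsub>G\<^esub>"]) auto
  next
    case (eng h1 h2)
    then obtain \<alpha> \<beta> \<alpha>' \<beta>' where *: "\<alpha> \<in> \<Gamma>" "\<beta> \<in> \<Gamma>" "\<alpha>' \<in> \<Gamma>" "\<beta>' \<in> \<Gamma>"
      "h1 = \<alpha> \<otimes>\<^bsub>G\<^esub> inv\<^bsub>G\<^esub> \<beta>" "h2 = \<alpha>' \<otimes>\<^bsub>G\<^esub> inv\<^bsub>G\<^esub> \<beta>'"
      by blast
    then have "h1 \<otimes>\<^bsub>G\<^esub> h2 = (\<alpha> \<otimes>\<^bsub>G\<^esub> \<alpha>') \<otimes>\<^bsub>G\<^esub> inv\<^bsub>G\<^esub> (\<beta> \<otimes>\<^bsub>G\<^esub> \<beta>')"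
      by (simp add: G.quotient_mult)
    with * show ?case
      using \<Gamma>_closed by blast
  qed
  with that show thesis by blast
qed

text \<open>
  If \<open>n(\<alpha> - \<beta>) = n(\<alpha>' - \<beta>')\<close> then \<open>n(\<alpha> + \<beta>') = n(\<alpha>' + \<beta>)\<close> inside \<open>\<Gamma>\<close>, where
  torsionlessness may be applied.
\<close>

lemma torsionless_\<Delta>: "torsionless_monoid G \<Delta>"
  unfolding torsionless_monoid_def
proof (intro conjI ballI allI impI)
  show "submonoid \<Delta> G"
    using \<Delta>_subgroup by (simp add: subgroup.subset subgroup.m_closed subgroup.one_closed submonoid_def)
next
  fix \<gamma> \<delta> and n :: nat
  assume "\<gamma> \<in> \<Delta>" "\<delta> \<in> \<Delta>" and n: "n > 0" and eq: "\<gamma> [^]\<^bsub>G\<^esub> n = \<delta> [^]\<^bsub>G\<^esub> n"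
  then obtain \<alpha> \<beta> \<alpha>' \<beta>' where *: "\<alpha> \<in> \<Gamma>" "\<beta> \<in> \<Gamma>" "\<alpha>' \<in> \<Gamma>" "\<beta>' \<in> \<Gamma>"
    "\<gamma> = \<alpha> \<otimes>\<^bsub>G\<^esub> inv\<^bsub>G\<^esub> \<beta>" "\<delta> = \<alpha>' \<otimes>\<^bsub>G\<^esub> inv\<^bsub>G\<^esub> \<beta>'"
    by (meson \<Delta>_E)
  have "(\<alpha> [^]\<^bsub>G\<^esub> n) \<otimes>\<^bsub>G\<^esub> inv\<^bsub>G\<^esub> (\<beta> [^]\<^bsub>G\<^esub> n) = (\<alpha>' [^]\<^bsub>G\<^esub> n) \<otimes>\<^bsub>G\<^esub> inv\<^bsub>G\<^esub> (\<beta>' [^]\<^bsub>G\<^esub> n)"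
    using eq * by (simp add: G.nat_pow_distrib G.nat_pow_inv)
  then have "(\<alpha> [^]\<^bsub>G\<^esub> n) \<otimes>\<^bsub>G\<^esub> (\<beta>' [^]\<^bsub>G\<^esub> n) = (\<alpha>' [^]\<^bsub>G\<^esub> n) \<otimes>\<^bsub>G\<^esub> (\<beta> [^]\<^bsub>G\<^esub> n)"
    using * by (simp add: G.quotient_eq_iff)
  then have "(\<alpha> \<otimes>\<^bsub>G\<^esub> \<beta>') [^]\<^bsub>G\<^esub> n = (\<alpha>' \<otimes>\<^bsub>G\<^esub> \<beta>) [^]\<^bsub>G\<^esub> n"
    using * by (simp add: G.nat_pow_distrib)
  then have "\<alpha> \<otimes>\<^bsub>G\<^esub> \<beta>' = \<alpha>' \<otimes>\<^bsub>G\<^esub> \<beta>"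
    using \<Gamma>_torsionless[of "\<alpha> \<otimes>\<^bsub>G\<^esub> \<beta>'" "\<alpha>' \<otimes>\<^bsub>G\<^esub> \<beta>" n] n * by simp
  then show "\<gamma> = \<delta>"
    using * by (simp add: G.quotient_eq_iff)
qed

lemma RS_subring: "subring RS K"
proof (rule subringI)
  show "RS \<subseteq> carrier K"
    by (auto elim!: RS_E)
  obtain s where s: "s \<in> S"
    using S_nonempty by blast
  then have "s \<otimes> inv s \<in> RS"
    by (intro RS_I) auto
  then show "\<one> \<in> RS"
    using s by simp
next
  fix x assume "x \<in> RS"
  then obtain a s where *: "a \<in> R" "s \<in> S" "x = a \<otimes> inv s"
    by (rule RS_E)
  then have "\<ominus> x = (\<ominus> a) \<otimes> inv s"
    by (simp add: l_minus)
  with * show "\<ominus> x \<in> RS"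
    using subringE(5)[OF R_subring] by (auto intro: RS_I)
next
  fix x y assume "x \<in> RS" "y \<in> RS"
  then obtain a s b t where *: "a \<in> R" "s \<in> S" "x = a \<otimes> inv s" "b \<in> R" "t \<in> S" "y = b \<otimes> inv t"
    by (meson RS_E)
  then have "x \<otimes> y = (a \<otimes> b) \<otimes> inv (s \<otimes> t)" "x \<oplus> y = (a \<otimes> t \<oplus> b \<otimes> s) \<otimes> inv (s \<otimes> t)"
    by (simp_all add: fraction_mult fraction_add)
  with * show "x \<otimes> y \<in> RS" "x \<oplus> y \<in> RS"
    using subringE(6,7)[OF R_subring] by (auto intro!: RS_I)
qed

lemma R_le_RS: "R \<subseteq> RS"
proof
  fix a assume a: "a \<in> R"
  obtain s where s: "s \<in> S"
    using S_nonempty by blast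
  have "(a \<otimes> s) \<otimes> inv s = a"
    using a s by (intro fraction_eqI) auto
  moreover have "(a \<otimes> s) \<otimes> inv s \<in> RS"
    using a s subringE(6)[OF R_subring] by (intro RS_I) auto
  ultimately show "a \<in> RS"
    by simp
qed

lemma RS_carrier [simp]: "x \<in> RS \<Longrightarrow> x \<in> carrier K"
  using subringE(1)[OF RS_subring] by blast

lemma RS_inverse: "s \<in> S \<Longrightarrow> inv s \<in> RS"
  using RS_I[of \<one> s] subringE(3)[OF R_subring] by simp

lemma N_RS: "x \<in> N \<gamma> \<Longrightarrow> x \<in> RS"
  using subringE(2)[OF RS_subring] by (auto elim!: N_E intro: RS_I M_R)

lemma M_le_N:
  assumes "\<alpha> \<in> \<Gamma>"
  shows "M \<alpha> \<subseteq> N \<alpha>"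
proof
  fix a assume a: "a \<in> M \<alpha>"
  obtain s \<beta> where s: "s \<in> S" "\<beta> \<in> \<Gamma>" "s \<in> M \<beta>"
    using S_nonempty S_degree by blast
  have "(a \<otimes> s) \<otimes> inv s = a"
    using a s assms M_R by (intro fraction_eqI) auto
  moreover have "\<alpha> = (\<alpha> \<otimes>\<^bsub>G\<^esub> \<beta>) \<otimes>\<^bsub>G\<^esub> inv\<^bsub>G\<^esub> \<beta>"
    using assms s by (simp add: G.m_assoc)
  then have "(a \<otimes> s) \<otimes> inv s \<in> N \<alpha>"
    using assms s a by (intro N_I[of "\<alpha> \<otimes>\<^bsub>G\<^esub> \<beta>" \<beta>]) auto
  ultimately show "a \<in> N \<alpha>"
    by simp
qed

lemma N_subgroup: "additive_subgroup (N \<gamma>) K"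
proof (rule additive_subgroupI, rule add.subgroupI)
  show "N \<gamma> \<subseteq> carrier K"
    using N_RS by auto
  show "N \<gamma> \<noteq> {}"
    using N_zero by blast
next
  fix x assume "x \<in> N \<gamma>"
  then show "\<ominus> x \<in> N \<gamma>"
  proof (cases rule: N_E)
    case (2 a s \<alpha> \<beta>)
    then have "\<ominus> x = (\<ominus> a) \<otimes> inv s"
      using M_R by (simp add: l_minus)
    moreover have "\<ominus> a \<in> M \<alpha>"
      using 2 M_subgroup by (simp add: additive_subgroup.a_inv_closed)
    ultimately show ?thesis
      using 2 by (auto intro: N_I)
  qed simp
next
  fix x y assume x: "x \<in> N \<gamma>" and y: "y \<in> N \<gamma>"
  have c: "x \<in> carrier K" "y \<in> carrier K"
    using x y N_RS by auto
  from x show "x \<oplus> y \<in> N \<gamma>"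
  proof (cases rule: N_E)
    case x: (2 a s \<alpha> \<beta>)
    from y show ?thesis
    proof (cases rule: N_E)
      case y: (2 b t \<alpha>' \<beta>')
      have "\<alpha> \<otimes>\<^bsub>G\<^esub> \<beta>' = \<alpha>' \<otimes>\<^bsub>G\<^esub> \<beta>"
        using x y G.quotient_eq_iff[of \<alpha> \<beta> \<alpha>' \<beta>'] by simp
      then have "a \<otimes> t \<oplus> b \<otimes> s \<in> M (\<alpha> \<otimes>\<^bsub>G\<^esub> \<beta>')"
        using x y M_mult[of \<alpha> \<beta>' a t] M_mult[of \<alpha>' \<beta> b s]
        by (simp add: additive_subgroup.a_closed[OF M_subgroup])
      moreover have "\<gamma> = (\<alpha> \<otimes>\<^bsub>G\<^esub> \<beta>') \<otimes>\<^bsub>G\<^esub> inv\<^bsub>G\<^esub> (\<beta> \<otimes>\<^bsub>G\<^esub> \<beta>')"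
        unfolding x(7) using x(1,2) y(1,2) by (subst G.quotient_eq_iff) (simp_all add: G.m_ac)
      ultimately have "(a \<otimes> t \<oplus> b \<otimes> s) \<otimes> inv (s \<otimes> t) \<in> N \<gamma>"
        using x y by (intro N_I[of "\<alpha> \<otimes>\<^bsub>G\<^esub> \<beta>'" "\<beta> \<otimes>\<^bsub>G\<^esub> \<beta>'"]) auto
      then show ?thesis
        using x y M_R by (simp add: fraction_add)
    qed (use c x in \<open>auto intro: N_I\<close>)
  qed (use c y in simp)
qed

lemma N_mult:
  assumes "x \<in> N \<gamma>" "y \<in> N \<delta>"
  shows "x \<otimes> y \<in> N (\<gamma> \<otimes>\<^bsub>G\<^esub> \<delta>)"
proof -
  have c: "x \<in> carrier K" "y \<in> carrier K"
    using assms N_RS by auto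
  from assms(1) show ?thesis
  proof (cases rule: N_E)
    case x: (2 a s \<alpha> \<beta>)
    from assms(2) show ?thesis
    proof (cases rule: N_E)
      case y: (2 b t \<alpha>' \<beta>')
      have "(a \<otimes> b) \<otimes> inv (s \<otimes> t) \<in> N (\<gamma> \<otimes>\<^bsub>G\<^esub> \<delta>)"
        using x y by (intro N_I[of "\<alpha> \<otimes>\<^bsub>G\<^esub> \<alpha>'" "\<beta> \<otimes>\<^bsub>G\<^esub> \<beta>'"]) (auto simp: G.quotient_mult)
      then show ?thesis
        using x y M_R by (simp add: fraction_mult)
    qed (use c in simp)
  qed (use c in simp)
qed

text \<open>
  Multiply the denominators together.  Zero has to be excluded: it lies in every component
  \<open>N \<gamma>\<close>, even if no sum of \<open>\<gamma>\<close> with the degree of an element of \<open>S\<close> belongs to \<open>\<Gamma>\<close>.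
\<close>

lemma common_denominator:
  assumes "finite F" "\<And>\<gamma>. \<gamma> \<in> F \<Longrightarrow> x \<gamma> \<in> N \<gamma> - {\<zero>}"
  shows "\<exists>s\<in>S. \<exists>\<beta>\<in>\<Gamma>. s \<in> M \<beta> \<and> (\<forall>\<gamma>\<in>F. \<gamma> \<otimes>\<^bsub>G\<^esub> \<beta> \<in> \<Gamma> \<and> x \<gamma> \<otimes> s \<in> M (\<gamma> \<otimes>\<^bsub>G\<^esub> \<beta>))"
  using assms
proof (induction F rule: finite_induct)
  case empty
  then show ?case
    using S_nonempty S_degree by blast
next
  case (insert \<delta> F)
  then obtain s \<beta> where s: "s \<in> S" "\<beta> \<in> \<Gamma>" "s \<in> M \<beta>"
    and F: "\<And>\<gamma>. \<gamma> \<in> F \<Longrightarrow> \<gamma> \<otimes>\<^bsub>G\<^esub> \<beta> \<in> \<Gamma> \<and> x \<gamma> \<otimes> s \<in> M (\<gamma> \<otimes>\<^bsub>G\<^esub> \<beta>)"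
    by (metis insertCI)
  from insert.prems[of \<delta>] obtain a t \<alpha> \<beta>' where t: "\<alpha> \<in> \<Gamma>" "\<beta>' \<in> \<Gamma>" "a \<in> M \<alpha>" "t \<in> S" "t \<in> M \<beta>'"
    "x \<delta> = a \<otimes> inv t" "\<delta> = \<alpha> \<otimes>\<^bsub>G\<^esub> inv\<^bsub>G\<^esub> \<beta>'"
    by (auto elim: N_E)
  have "\<gamma> \<otimes>\<^bsub>G\<^esub> (\<beta> \<otimes>\<^bsub>G\<^esub> \<beta>') \<in> \<Gamma> \<and> x \<gamma> \<otimes> (s \<otimes> t) \<in> M (\<gamma> \<otimes>\<^bsub>G\<^esub> (\<beta> \<otimes>\<^bsub>G\<^esub> \<beta>'))"
    if "\<gamma> \<in> insert \<delta> F" for \<gamma>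
  proof (cases "\<gamma> = \<delta>")
    case True
    have "inv\<^bsub>G\<^esub> \<beta>' \<otimes>\<^bsub>G\<^esub> (\<beta>' \<otimes>\<^bsub>G\<^esub> \<beta>) = \<beta>"
      using s t by (simp add: G.m_assoc[symmetric])
    then have "\<gamma> \<otimes>\<^bsub>G\<^esub> (\<beta> \<otimes>\<^bsub>G\<^esub> \<beta>') = \<alpha> \<otimes>\<^bsub>G\<^esub> \<beta>"
      unfolding True t(7) using s t by (simp add: G.m_assoc G.m_comm[of \<beta> \<beta>'])
    moreover have "x \<gamma> \<otimes> (s \<otimes> t) = ((a \<otimes> inv t) \<otimes> t) \<otimes> s"
      unfolding True t(6) using s t M_R by (simp add: m_ac del: nonzero_inv(2,3))
    then have "x \<gamma> \<otimes> (s \<otimes> t) = a \<otimes> s"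
      using s t M_R by (simp add: fraction_mult_denominator)
    ultimately show ?thesis
      using s t by simp
  next
    case False
    with that have \<gamma>: "\<gamma> \<in> F" by simp
    with insert.prems[of \<gamma>] have xc: "x \<gamma> \<in> N \<gamma>" "x \<gamma> \<in> carrier K" "x \<gamma> \<noteq> \<zero>"
      using N_RS by auto
    then have \<gamma>c: "\<gamma> \<in> carrier G"
      by (auto elim!: N_E)
    have "(\<gamma> \<otimes>\<^bsub>G\<^esub> \<beta>) \<otimes>\<^bsub>G\<^esub> \<beta>' \<in> \<Gamma>" "(x \<gamma> \<otimes> s) \<otimes> t \<in> M ((\<gamma> \<otimes>\<^bsub>G\<^esub> \<beta>) \<otimes>\<^bsub>G\<^esub> \<beta>')"
      using F[OF \<gamma>] t by simp_all
    then show ?thesis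
      using s t xc \<gamma>c by (simp add: m_assoc G.m_assoc)
  qed
  then show ?case
    using s t by (intro bexI[of _ "s \<otimes> t"] bexI[of _ "\<beta> \<otimes>\<^bsub>G\<^esub> \<beta>'"] conjI ballI) simp_all
qed

text \<open>
  Spanning: dividing the components of \<open>a\<close> by \<open>s\<close> gives components of \<open>a / s\<close>.
  Independence: a relation among nonzero homogeneous fractions becomes, after multiplication by a
  homogeneous common denominator of degree \<open>\<beta>\<close>, a relation in \<open>R\<close> whose degrees are those of
  the original one shifted by \<open>\<beta>\<close>; the shift is injective, so directness of \<open>R\<close> applies.
\<close>

lemma N_direct: "internal_direct_sum K \<Delta> N RS"
proof -
  have "RS \<subseteq> family_sum K \<Delta> N"
  proof
    fix x assume "x \<in> RS"
    then obtain a s where x: "a \<in> R" "s \<in> S" "x = a \<otimes> inv s"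
      by (rule RS_E)
    obtain \<beta> where \<beta>: "\<beta> \<in> \<Gamma>" "s \<in> M \<beta>"
      using x S_degree by blast
    obtain u F where u: "finite F" "F \<subseteq> \<Gamma>" "u \<in> Pi F M" "a = finsum K u F"
      using x R_sum by (auto simp: family_sum_def)
    have uc: "u \<in> F \<rightarrow> carrier K"
      using Pi_additive_subgroups[of \<Gamma> M, OF M_subgroup u(2,3)] .
    have "u \<alpha> \<otimes> inv s \<in> family_sum K \<Delta> N" if "\<alpha> \<in> F" for \<alpha>
    proof (rule family_sum_member[of \<Delta> N])
      show "\<alpha> \<otimes>\<^bsub>G\<^esub> inv\<^bsub>G\<^esub> \<beta> \<in> \<Delta>"
        using that u \<beta> by (intro \<Delta>_I) auto
      show "u \<alpha> \<otimes> inv s \<in> N (\<alpha> \<otimes>\<^bsub>G\<^esub> inv\<^bsub>G\<^esub> \<beta>)"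
        using that u(2,3) x \<beta> by (intro N_I[of \<alpha> \<beta>]) auto
    qed (rule N_subgroup)
    then have "finsum K (\<lambda>\<alpha>. u \<alpha> \<otimes> inv s) F \<in> family_sum K \<Delta> N"
      by (intro finsum_in_additive_subgroup[OF additive_subgroup_family_sum[OF N_subgroup]]) simp
    then show "x \<in> family_sum K \<Delta> N"
      unfolding x(3) u(4) using u(1) uc x(2) by (simp add: finsum_ldistr)
  qed
  moreover have "family_sum K \<Delta> N \<subseteq> RS"
    by (rule family_sum_minimal)
      (use N_RS RS_subring in \<open>auto simp: subring_def intro: additive_subgroupI\<close>)
  moreover have "\<forall>\<gamma>\<in>F. x \<gamma> = \<zero>"
    if F: "finite F" "F \<subseteq> \<Delta>" and xN: "x \<in> Pi F N" and sum: "finsum K x F = \<zero>" for F x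
  proof (rule ccontr)
    assume "\<not> (\<forall>\<gamma>\<in>F. x \<gamma> = \<zero>)"
    then obtain \<delta> where \<delta>: "\<delta> \<in> F" "x \<delta> \<noteq> \<zero>"
      by blast
    define E where "E = {\<gamma>\<in>F. x \<gamma> \<noteq> \<zero>}"
    have E: "finite E" "E \<subseteq> \<Delta>" "E \<subseteq> F"
      using F by (auto simp: E_def)
    have xc: "x \<gamma> \<in> carrier K" if "\<gamma> \<in> F" for \<gamma>
      using that xN by (intro RS_carrier N_RS[of "x \<gamma>" \<gamma>]) blast
    have xE: "x \<gamma> \<in> N \<gamma> - {\<zero>}" if "\<gamma> \<in> E" for \<gamma>
      using that xN by (auto simp: E_def)
    obtain s \<beta> where s: "s \<in> S" "\<beta> \<in> \<Gamma>" "s \<in> M \<beta>"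
      and sE: "\<And>\<gamma>. \<gamma> \<in> E \<Longrightarrow> \<gamma> \<otimes>\<^bsub>G\<^esub> \<beta> \<in> \<Gamma> \<and> x \<gamma> \<otimes> s \<in> M (\<gamma> \<otimes>\<^bsub>G\<^esub> \<beta>)"
      using common_denominator[of E x, OF E(1) xE] by blast
    \<comment> \<open>Restricting to \<open>E\<close> keeps all shifted degrees in \<open>\<Gamma>\<close>, where \<open>M\<close> is the grading of \<open>R\<close>.\<close>
    define shift where "shift = (\<lambda>\<gamma>. \<gamma> \<otimes>\<^bsub>G\<^esub> \<beta>)"
    define y where "y = (\<lambda>\<alpha>. x (\<alpha> \<otimes>\<^bsub>G\<^esub> inv\<^bsub>G\<^esub> \<beta>) \<otimes> s)"
    have y_shift: "y (shift \<gamma>) = x \<gamma> \<otimes> s" if "\<gamma> \<in> E" for \<gamma>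
      using that E s by (auto simp: y_def shift_def G.m_assoc)
    have inj: "inj_on shift E"
      using E s by (auto simp: inj_on_def shift_def subset_iff)
    have yM: "y \<in> Pi (shift ` E) M"
      using sE y_shift by (auto simp: shift_def)
    have yc: "y \<in> shift ` E \<rightarrow> carrier K"
      using y_shift xc E s by auto
    have "finsum K y (shift ` E) = finsum K (\<lambda>\<gamma>. y (shift \<gamma>)) E"
      using yc inj by (rule finsum_reindex)
    also have "\<dots> = finsum K (\<lambda>\<gamma>. x \<gamma> \<otimes> s) E"
      using y_shift xc E s by (intro finsum_cong') auto
    also have "\<dots> = finsum K x E \<otimes> s"
      using xc E s by (subst finsum_ldistr) auto
    also have "finsum K x E = finsum K x F"
      by (rule add.finprod_mono_neutral_cong_left) (use F xc in \<open>auto simp: E_def\<close>)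
    finally have "finsum K y (shift ` E) = \<zero>"
      using sum s by simp
    moreover have "\<delta> \<in> E"
      using \<delta> by (simp add: E_def)
    ultimately have "y (shift \<delta>) = \<zero>"
      using internal_direct_sumD(3)[OF direct, of "shift ` E" y "shift \<delta>"] E(1) sE yM
      by (auto simp: shift_def)
    then have "x \<delta> \<otimes> s = \<zero>"
      using y_shift \<open>\<delta> \<in> E\<close> by simp
    then show False
      using \<delta> xc s by (simp add: integral_iff)
  qed
  ultimately show ?thesis
    unfolding internal_direct_sum_def family_sum_def[symmetric]
    using N_subgroup by blast
qed

lemma graded_domain_fractions: "graded_domain K G \<Delta> RS N"
proof -
  have "\<Gamma> \<noteq> {\<one>\<^bsub>G\<^esub>}"
    using graded by (simp add: graded_domain_def)
  then have "\<Delta> \<noteq> {\<one>\<^bsub>G\<^esub>}"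
    using \<Gamma>_one \<Gamma>_\<Delta> by blast
  then show ?thesis
    unfolding graded_domain_def
    using field_axioms G.comm_group_axioms torsionless_\<Delta> RS_subring N_direct N_mult by simp
qed

section \<open>Homogeneous overrings and contraction of primes\<close>

lemma generate_\<Delta>: "generate G \<Delta> = \<Delta>"
  using G.generateI[OF \<Delta>_subgroup subset_refl] by simp

lemma nonzero_homogeneous_le: "nonzero_homogeneous K \<Gamma> M \<subseteq> nonzero_homogeneous K \<Delta> N"
  using M_le_N \<Gamma>_\<Delta> unfolding nonzero_homogeneous_def by blast

text \<open>
  A fraction of fractions \<open>(a / s) / (b / t)\<close> is the fraction \<open>at / sb\<close>, of the same
  degree.  Both homogeneous quotient fields are the sums of their components, so their equality
  follows from that of the gradings.
\<close>

lemma hom_quotient_grading_eq: "hom_quotient_grading K G \<Delta> N = hom_quotient_grading K G \<Gamma> M"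
  and hom_quotient_field_eq: "hom_quotient_field K \<Delta> RS N = hom_quotient_field K \<Gamma> R M"
proof -
  have ne: "nonzero_homogeneous K \<Gamma> M \<noteq> {}" "nonzero_homogeneous K \<Delta> N \<noteq> {}"
    using S_hom S_nonempty nonzero_homogeneous_le by auto
  interpret H: graded_fractions K G \<Gamma> R M "nonzero_homogeneous K \<Gamma> M"
    by unfold_locales (use graded mult_closed_nonzero_homogeneous[OF graded] ne in auto)
  interpret L: graded_fractions K G \<Delta> RS N "nonzero_homogeneous K \<Delta> N"
    by unfold_locales 
      (use graded_domain_fractions mult_closed_nonzero_homogeneous[OF graded_domain_fractions] ne in auto)
  have eq: "L.N \<gamma> = H.N \<gamma>" for \<gamma>
  proof
    show "L.N \<gamma> \<subseteq> H.N \<gamma>"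
    proof
      fix x assume "x \<in> L.N \<gamma>"
      then show "x \<in> H.N \<gamma>"
      proof (cases rule: L.N_E)
        case x: (2 u v \<delta> \<epsilon>)
        have c: "u \<in> carrier K" "v \<in> carrier K" "v \<noteq> \<zero>"
          using x N_RS L.S_nonzero by auto
        from \<open>u \<in> N \<delta>\<close> show ?thesis
        proof (cases rule: N_E)
          case u: (2 a s \<alpha> \<beta>)
          from \<open>v \<in> N \<epsilon>\<close> show ?thesis
          proof (cases rule: N_E)
            case v: (2 b t \<alpha>' \<beta>')
            have b: "b \<in> carrier K" "b \<noteq> \<zero>"
              using v c M_R by auto
            have "x = (a \<otimes> inv s) \<otimes> (t \<otimes> inv b)"
              using x u v b M_R by (simp add: inv_fraction)
            also have "\<dots> = (a \<otimes> t) \<otimes> inv (s \<otimes> b)"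
              using u v b M_R by (intro fraction_mult) auto
            finally have x_eq: "x = (a \<otimes> t) \<otimes> inv (s \<otimes> b)" .
            have "inv\<^bsub>G\<^esub> \<epsilon> = \<beta>' \<otimes>\<^bsub>G\<^esub> inv\<^bsub>G\<^esub> \<alpha>'"
              unfolding v(7) using v(1,2) by (simp add: G.inv_mult G.m_comm)
            then have deg: "\<gamma> = (\<alpha> \<otimes>\<^bsub>G\<^esub> \<beta>') \<otimes>\<^bsub>G\<^esub> inv\<^bsub>G\<^esub> (\<beta> \<otimes>\<^bsub>G\<^esub> \<alpha>')"
              unfolding x(7) u(7) using u(1,2) v(1,2) by (simp add: G.quotient_mult)
            have "s \<in> nonzero_homogeneous K \<Gamma> M"
              using \<open>s \<in> S\<close> S_hom by blast
            moreover have "b \<in> nonzero_homogeneous K \<Gamma> M"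
              unfolding nonzero_homogeneous_def using v(1,3) b(2) by blast
            ultimately have "s \<otimes> b \<in> nonzero_homogeneous K \<Gamma> M"
              by (rule H.S_closed)
            then show ?thesis
              unfolding x_eq using u v deg
              by (simp add: H.N_I[of "\<alpha> \<otimes>\<^bsub>G\<^esub> \<beta>'" "\<beta> \<otimes>\<^bsub>G\<^esub> \<alpha>'"])
          qed (use c in simp)
        qed (use x c in simp)
      qed simp
    qed
    show "H.N \<gamma> \<subseteq> L.N \<gamma>"
    proof
      fix x assume "x \<in> H.N \<gamma>"
      then show "x \<in> L.N \<gamma>"
      proof (cases rule: H.N_E)
        case (2 a s \<alpha> \<beta>)
        then show ?thesis
          using M_le_N \<Gamma>_\<Delta> nonzero_homogeneous_le by (auto intro!: L.N_I[of \<alpha> \<beta>])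
      qed simp
    qed
  qed
  then show g: "hom_quotient_grading K G \<Delta> N = hom_quotient_grading K G \<Gamma> M"
    unfolding hom_quotient_grading_def by (rule ext)
  show "hom_quotient_field K \<Delta> RS N = hom_quotient_field K \<Gamma> R M"
    unfolding hom_quotient_field_def
    using internal_direct_sumD(2)[OF H.N_direct] internal_direct_sumD(2)[OF L.N_direct]
      ext[of L.N H.N, OF eq] generate_\<Delta> by simp
qed

lemma overring_grading_eq: "overring_grading K G \<Delta> N = overring_grading K G \<Gamma> M"
  unfolding overring_grading_def[abs_def] by (simp add: hom_quotient_grading_eq)

lemma homogeneous_overring_fractions:
  assumes "homogeneous_overring K G \<Delta> RS N T"
  shows "homogeneous_overring K G \<Gamma> R M T"
  using assms R_le_RS unfolding homogeneous_overring_def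
  by (auto simp: overring_grading_eq hom_quotient_field_eq generate_\<Delta>)

text \<open>
  Homogeneity survives contraction because the components in \<open>R\<close> of an element of
  \<open>R\<close> are also its components in \<open>R\<^sub>S\<close>, and the latter lie in \<open>P\<close>.
\<close>

lemma contraction_homogeneous_prime:
  assumes "homogeneous_prime K \<Delta> RS N P"
  shows "homogeneous_prime K \<Gamma> R M (P \<inter> R)"
proof -
  have prime: "primeideal P (K\<lparr>carrier := RS\<rparr>)" and idP: "ideal P (K\<lparr>carrier := RS\<rparr>)"
    and homP: "P \<subseteq> family_sum K \<Delta> (\<lambda>\<gamma>. N \<gamma> \<inter> P)"
    using assms homogeneous_ideal_iff[OF graded_domain_fractions]
    by (auto simp: homogeneous_prime_def)
  have P: "additive_subgroup P K" "P \<subseteq> RS" "\<And>a x. a \<in> RS \<Longrightarrow> x \<in> P \<Longrightarrow> a \<otimes> x \<in> P"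
    using idP ideal_subring_iff[OF RS_subring] by auto
  have R_add: "additive_subgroup R K"
    using R_subring by (auto simp: subring_def intro: additive_subgroupI)
  have R_mult: "a \<otimes> x \<in> R" if "a \<in> R" "x \<in> R" for a x
    using that subringE(6)[OF R_subring] by simp
  have "additive_subgroup (P \<inter> R) K"
    using P(1) R_add by (rule additive_subgroup_Int)
  moreover have "\<forall>a\<in>R. \<forall>x\<in>P \<inter> R. a \<otimes> x \<in> P \<inter> R"
    using P(3) R_le_RS R_mult by blast
  ultimately have id: "ideal (P \<inter> R) (K\<lparr>carrier := R\<rparr>)"
    using ideal_subring_iff[OF R_subring] by simp
  have "primeideal (P \<inter> R) (K\<lparr>carrier := R\<rparr>)"
  proof (rule primeidealI[OF id])
    show "cring (K\<lparr>carrier := R\<rparr>)"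
      using subcringI'[OF R_subring] subcring_iff[of R] subringE(1)[OF R_subring] by simp
    show "carrier (K\<lparr>carrier := R\<rparr>) \<noteq> P \<inter> R"
    proof
      assume "carrier (K\<lparr>carrier := R\<rparr>) = P \<inter> R"
      then have "\<one> \<in> P"
        using subringE(3)[OF R_subring] by auto
      then have "RS \<subseteq> P"
        using P(3)[of _ \<one>] by auto
      then show False
        using P(2) primeideal.I_notcarr[OF prime] by auto
    qed
    show "a \<in> P \<inter> R \<or> b \<in> P \<inter> R"
      if "a \<in> carrier (K\<lparr>carrier := R\<rparr>)" "b \<in> carrier (K\<lparr>carrier := R\<rparr>)"
        "a \<otimes>\<^bsub>K\<lparr>carrier := R\<rparr>\<^esub> b \<in> P \<inter> R" for a b
      using primeideal.I_prime[OF prime, of a b] that R_le_RS by auto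
  qed
  moreover have "P \<inter> R \<subseteq> family_sum K \<Gamma> (\<lambda>\<alpha>. M \<alpha> \<inter> (P \<inter> R))"
  proof
    fix x assume x: "x \<in> P \<inter> R"
    obtain u F where u: "finite F" "F \<subseteq> \<Gamma>" "u \<in> Pi F M" "x = finsum K u F"
      using x R_sum by (auto simp: family_sum_def)
    obtain v E where v: "finite E" "E \<subseteq> \<Delta>" "v \<in> Pi E (\<lambda>\<gamma>. N \<gamma> \<inter> P)" "x = finsum K v E"
      using x homP by (auto simp: family_sum_def)
    have "u \<alpha> \<in> M \<alpha> \<inter> (P \<inter> R)" if \<alpha>: "\<alpha> \<in> F" for \<alpha>
    proof -
      have "u \<alpha> = (if \<alpha> \<in> E then v \<alpha> else \<zero>)"
      proof (rule internal_direct_sum_unique[OF N_direct u(1) _ _ v(1,2) _ _ \<alpha>])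
        show "F \<subseteq> \<Delta>" "u \<in> Pi F N" "v \<in> Pi E N" "finsum K u F = finsum K v E"
          using u v \<Gamma>_\<Delta> M_le_N by blast+
      qed
      then have "u \<alpha> \<in> P"
        using v(3) additive_subgroup.zero_closed[OF P(1)] by auto
      moreover have "u \<alpha> \<in> M \<alpha>" "\<alpha> \<in> \<Gamma>"
        using u \<alpha> by auto
      ultimately show ?thesis
        using M_R by blast
    qed
    then show "x \<in> family_sum K \<Gamma> (\<lambda>\<alpha>. M \<alpha> \<inter> (P \<inter> R))"
      unfolding family_sum_def u(4) using u(1,2) by (intro CollectI exI conjI refl) auto
  qed
  ultimately show ?thesis
    using id homogeneous_ideal_iff[OF graded] by (simp add: homogeneous_prime_def)
qed

text \<open>
  Elements of \<open>S\<close> are units of every ring between \<open>R\<^sub>S\<close> and \<open>K\<close>.  Consequently an ideal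
  of such a ring is determined on \<open>R\<^sub>S\<close> by its trace on \<open>R\<close>.
\<close>

lemma mem_ideal_iff_numerator:
  assumes T: "subring T K" "RS \<subseteq> T" and I: "ideal I (K\<lparr>carrier := T\<rparr>)"
    and "a \<in> R" "s \<in> S"
  shows "a \<otimes> inv s \<in> I \<longleftrightarrow> a \<in> I"
proof -
  have m: "\<And>a x. a \<in> T \<Longrightarrow> x \<in> I \<Longrightarrow> a \<otimes> x \<in> I"
    using I ideal_subring_iff[OF T(1)] by auto
  have "s \<in> T" "inv s \<in> T"
    using assms RS_inverse R_le_RS S_R by blast+
  then have "a \<otimes> inv s \<in> I \<Longrightarrow> s \<otimes> (a \<otimes> inv s) \<in> I" "a \<in> I \<Longrightarrow> inv s \<otimes> a \<in> I"
    using m by auto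
  moreover have "s \<otimes> (a \<otimes> inv s) = a" "inv s \<otimes> a = a \<otimes> inv s"
    using assms(4,5) fraction_mult_denominator[of s a] by (simp_all add: m_comm)
  ultimately show ?thesis
    by auto
qed

text \<open>
  Contract the data \<open>P\<^sub>0 \<subseteq> P\<close> to \<open>R\<close> and go down there.  The prime \<open>Q\<^sub>0\<close> so obtained has the same
  trace on \<open>R\<close> as \<open>P\<^sub>0\<close>, hence the same trace on \<open>R\<^sub>S\<close>.
\<close>

lemma gGD_fractions:
  assumes T: "subring T K" "RS \<subseteq> T" and gd: "gGD K \<Gamma> R M \<Theta> T L"
  shows "gGD K \<Delta> RS N \<Theta> T L"
  unfolding gGD_def
proof (intro allI impI, elim conjE)
  fix P\<^sub>0 P Q
  assume P0: "homogeneous_prime K \<Delta> RS N P\<^sub>0" and P: "homogeneous_prime K \<Delta> RS N P"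
    and le: "P\<^sub>0 \<subseteq> P" and Q: "homogeneous_prime K \<Theta> T L Q" and QP: "Q \<inter> RS = P"
  have "Q \<inter> R = P \<inter> R"
    using QP R_le_RS by blast
  then obtain Q\<^sub>0 where Q0: "homogeneous_prime K \<Theta> T L Q\<^sub>0" "Q\<^sub>0 \<subseteq> Q" "Q\<^sub>0 \<inter> R = P\<^sub>0 \<inter> R"
    using gd contraction_homogeneous_prime[OF P0] contraction_homogeneous_prime[OF P] le Q
    unfolding gGD_def by blast
  have idP: "ideal P\<^sub>0 (K\<lparr>carrier := RS\<rparr>)" and idQ: "ideal Q\<^sub>0 (K\<lparr>carrier := T\<rparr>)"
    using P0 Q0 by (auto simp: homogeneous_prime_def homogeneous_ideal_def)
  have "x \<in> Q\<^sub>0 \<longleftrightarrow> x \<in> P\<^sub>0" if "x \<in> RS" for x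
    using that
  proof (rule RS_E)
    fix a s assume x: "a \<in> R" "s \<in> S" "x = a \<otimes> inv s"
    then have "x \<in> Q\<^sub>0 \<longleftrightarrow> a \<in> Q\<^sub>0" "x \<in> P\<^sub>0 \<longleftrightarrow> a \<in> P\<^sub>0"
      using mem_ideal_iff_numerator[OF T idQ] mem_ideal_iff_numerator[OF RS_subring order_refl idP]
      by simp_all
    moreover have "a \<in> Q\<^sub>0 \<longleftrightarrow> a \<in> P\<^sub>0"
      using Q0(3) x(1) by blast
    ultimately show ?thesis
      by simp
  qed
  moreover have "P\<^sub>0 \<subseteq> RS"
    using idP ideal_subring_iff[OF RS_subring] by simp
  ultimately have "Q\<^sub>0 \<inter> RS = P\<^sub>0"
    by blast
  then show "\<exists>Q\<^sub>0. homogeneous_prime K \<Theta> T L Q\<^sub>0 \<and> Q\<^sub>0 \<subseteq> Q \<and> Q\<^sub>0 \<inter> RS = P\<^sub>0"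
    using Q0 by blast
qed

end

theorem mainTheorem4:
  fixes K :: "('a, 'm) ring_scheme" and G :: "('g, 'n) monoid_scheme"
    and \<Gamma> :: "'g set" and R :: "'a set" and M :: "'g \<Rightarrow> 'a set" and S :: "'a set"
  assumes "gGD_domain K G \<Gamma> R M"
    and "S \<subseteq> nonzero_homogeneous K \<Gamma> M" and "mult_closed K S"
  shows "gGD_domain K G (generate G \<Gamma>) (fractions K R S) (fraction_grading K G \<Gamma> M S)"
proof -
  have graded: "graded_domain K G \<Gamma> R M"
    using assms(1) by (simp add: gGD_domain_def)
  interpret field K
    using graded by (simp add: graded_domain_def)
  interpret graded_fractions K G \<Gamma> R M S
    by unfold_locales (use graded assms in auto)
  have "gGD K \<Delta> RS N (generate G \<Delta>) T (overring_grading K G \<Delta> N T)"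
    if T: "homogeneous_overring K G \<Delta> RS N T" for T
  proof -
    have "gGD K \<Gamma> R M \<Delta> T (overring_grading K G \<Gamma> M T)"
      using assms(1) homogeneous_overring_fractions[OF T] by (simp add: gGD_domain_def)
    moreover have "subring T K" "RS \<subseteq> T"
      using T by (auto simp: homogeneous_overring_def)
    ultimately show ?thesis
      unfolding generate_\<Delta> overring_grading_eq by (intro gGD_fractions)
  qed
  then show ?thesis
    using graded_domain_fractions by (simp add: gGD_domain_def)
qed

end
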